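(* The flip graph of labeled combinatorial 4-PPTs has diameter $\Omega(n\log n)$: there is a constant $c>0$ such that for all sufficiently large $n$ there exist two labeled combinatorial 4-PPTs on the same $n$ labeled vertices and with the same outer face (same labeled outer vertices in the same cyclic order) such that every sequence of flips transforming one into the other has length at least $c\, n\log n$.
   Context: An angle of a plane embedded graph is an incidence between a vertex and a face. A combinatorial pseudo-triangulation is a combinatorial embedding in the plane (rotation system with a designated outer face) of a connected planar simple graph, with a tag "reflex" or "convex" on each angle, such that every interior face has exactly three convex angles, all angles of the outer face are reflex, and no vertex is incident to more than one reflex angle. It is pointed if every vertex has exactly one reflex angle. A combinatorial 4-PPT is a combinatorial pointed pseudo-triangulation in which every interior face has size 3 or 4. A labeled combinatorial 4-PPT has distinct labels on its vertices. Flip: let $\triangle$ be an interior triangular face, $e$ an edge of $\triangle$ not on the outer face, $F$ the other face incident to $e$, and $R$ the region obtained by deleting $e$. A flip replaces $e$ by another edge $e'\ne e$ inside $R$ splitting $R$ into a triangular face and a face of the same size as $F$, such that the result (tags outside $R$ unchanged) is again a combinatorial 4-PPT; in particular $e'$ may not join two already adjacent vertices. Flips preserve labels and the outer face. *)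

theory Defs
  imports Complex_Main
begin

text \<open>A combinatorial plane embedding, given by a rotation system on a simple graph,
  with a designated outer face (as its set of darts) and a reflex/convex tag on
  every angle.  Angles are identified with darts: the dart (u,v) represents the
  angle at vertex v between the neighbours u and crot v u, and it lies on the
  face traced by (u,v).  A tag value True means reflex, False means convex.\<close>

record 'a cpt =
  cV :: "'a set"
  cE :: "'a set set"
  crot :: "'a \<Rightarrow> 'a \<Rightarrow> 'a"
  couter :: "('a \<times> 'a) set"
  creflex :: "'a \<times> 'a \<Rightarrow> bool"

definition nbrs :: "('a, 'z) cpt_scheme \<Rightarrow> 'a \<Rightarrow> 'a set" where
  "nbrs G v = {u. {v, u} \<in> cE G}"

definition darts :: "('a, 'z) cpt_scheme \<Rightarrow> ('a \<times> 'a) set" where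
  "darts G = {(u, v). {u, v} \<in> cE G}"

definition fnext :: "('a, 'z) cpt_scheme \<Rightarrow> 'a \<times> 'a \<Rightarrow> 'a \<times> 'a" where
  "fnext G d = (snd d, crot G (snd d) (fst d))"

definition face :: "('a, 'z) cpt_scheme \<Rightarrow> 'a \<times> 'a \<Rightarrow> ('a \<times> 'a) set" where
  "face G d = {(fnext G ^^ k) d | k. True}"

definition faces :: "('a, 'z) cpt_scheme \<Rightarrow> ('a \<times> 'a) set set" where
  "faces G = face G ` darts G"

definition comb_plane_embedding :: "('a, 'z) cpt_scheme \<Rightarrow> bool" where
  "comb_plane_embedding G \<longleftrightarrow>
     finite (cV G) \<and>
     (\<forall>e\<in>cE G. \<exists>x y. x \<noteq> y \<and> x \<in> cV G \<and> y \<in> cV G \<and> e = {x, y}) \<and>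
     (\<forall>u\<in>cV G. \<forall>v\<in>cV G. (\<lambda>x y. {x, y} \<in> cE G)\<^sup>*\<^sup>* u v) \<and>
     (\<forall>v u. u \<notin> nbrs G v \<longrightarrow> crot G v u = u) \<and>
     (\<forall>v. bij_betw (crot G v) (nbrs G v) (nbrs G v)) \<and>
     (\<forall>v. \<forall>u\<in>nbrs G v. \<forall>w\<in>nbrs G v. \<exists>k. (crot G v ^^ k) u = w) \<and>
     int (card (cV G)) - int (card (cE G)) + int (card (faces G)) = 2 \<and>
     couter G \<in> faces G"

definition comb_pt :: "('a, 'z) cpt_scheme \<Rightarrow> bool" where
  "comb_pt G \<longleftrightarrow>
     comb_plane_embedding G \<and>
     (\<forall>d. creflex G d \<longrightarrow> d \<in> darts G) \<and>
     (\<forall>f\<in>faces G. f \<noteq> couter G \<longrightarrow> card {d\<in>f. \<not> creflex G d} = 3) \<and>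
     (\<forall>d\<in>couter G. creflex G d) \<and>
     (\<forall>v\<in>cV G. card {d\<in>darts G. snd d = v \<and> creflex G d} \<le> 1)"

definition pointed :: "('a, 'z) cpt_scheme \<Rightarrow> bool" where
  "pointed G \<longleftrightarrow> (\<forall>v\<in>cV G. card {d\<in>darts G. snd d = v \<and> creflex G d} = 1)"

definition cppt4 :: "('a, 'z) cpt_scheme \<Rightarrow> bool" where
  "cppt4 G \<longleftrightarrow> comb_pt G \<and> pointed G \<and>
     (\<forall>f\<in>faces G. f \<noteq> couter G \<longrightarrow> card f \<in> {3, 4})"

definition del_rot :: "('a \<Rightarrow> 'a \<Rightarrow> 'a) \<Rightarrow> 'a \<Rightarrow> 'a \<Rightarrow> 'a \<Rightarrow> 'a \<Rightarrow> 'a" where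
  "del_rot r a b v u =
     (if v = a \<and> r a u = b then r a b
      else if v = b \<and> r b u = a then r b a
      else r v u)"

text \<open>Flip: (a,b) is a dart of an interior triangular face (the triangle), {a,b} is
  not on the outer face, F is the face of (b,a).  The edge {a,b} is replaced by a new
  edge {a',b'} (joining non-adjacent vertices) such that deleting the new edge from
  the result yields the same embedded graph as deleting {a,b} from the original, all
  faces away from the edges are unchanged (so the new edge lies in the merged region R),
  the two new faces have sizes 3 and |F|, tags outside R are unchanged, and the
  result is again a combinatorial 4-PPT (labels and outer face preserved).\<close>
definition flip4 :: "'a cpt \<Rightarrow> 'a cpt \<Rightarrow> bool" where
  "flip4 G G' \<longleftrightarrow> cppt4 G \<and> cppt4 G' \<and>
     (\<exists>a b a' b'.
        {a, b} \<in> cE G \<and>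
        face G (a, b) \<noteq> couter G \<and> card (face G (a, b)) = 3 \<and>
        (a, b) \<notin> couter G \<and> (b, a) \<notin> couter G \<and>
        a' \<noteq> b' \<and> {a', b'} \<notin> cE G \<and>
        cV G' = cV G \<and>
        cE G' = (cE G - {{a, b}}) \<union> {{a', b'}} \<and>
        (\<forall>(v, u)\<in>darts G - {(a, b), (b, a)}.
            del_rot (crot G) a b v u = del_rot (crot G') a' b' v u) \<and>
        {f\<in>faces G'. (a', b') \<notin> f \<and> (b', a') \<notin> f} =
          {f\<in>faces G. (a, b) \<notin> f \<and> (b, a) \<notin> f} \<and>
        ((card (face G' (a', b')) = 3 \<and> card (face G' (b', a')) = card (face G (b, a))) \<or>
         (card (face G' (a', b')) = card (face G (b, a)) \<and> card (face G' (b', a')) = 3)) \<and>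
        (\<forall>d\<in>darts G'. d \<notin> face G' (a', b') \<union> face G' (b', a') \<longrightarrow>
            creflex G' d = creflex G d) \<and>
        couter G' = couter G)"

end

theory Submission
  imports Defs "HOL-Combinatorics.Permutations" "HOL-Real_Asymp.Real_Asymp"
begin

text \<open>A counting argument.  If the outer face is a triangle, double counting of angles and
  Euler's formula leave exactly one interior triangle.  A flip changes the graph only at the
  boundedly many vertices of the faces at this triangle and its neighbours, hence every graph
  has at most \<open>D\<close> flips for a constant \<open>D\<close>, and at most \<open>D ^ K\<close> graphs can be reached by fewer
  than \<open>K\<close> flips.  On the other hand, nesting all but one of the vertices other than 0 and 1
  inside an outer triangle in an arbitrary order, each adjacent to both 0 and 1, gives
  \<open>(n - 3)!\<close> labeled graphs with the same outer face, and \<open>ln ((n - 3)!)\<close> grows like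
  \<open>n ln n\<close>.\<close>

section \<open>Faces of a plane embedding\<close>

lemma darts_sym: "(u, v) \<in> darts G \<longleftrightarrow> (v, u) \<in> darts G"
  by (simp add: darts_def insert_commute)

lemma nbrs_iff_darts: "u \<in> nbrs G v \<longleftrightarrow> (u, v) \<in> darts G"
  by (simp add: nbrs_def darts_def insert_commute)

lemma self_in_face: "d \<in> face G d"
  unfolding face_def by (auto intro: exI[of _ 0])

lemma fnext_in_face: "x \<in> face G d \<Longrightarrow> fnext G x \<in> face G d"
  unfolding face_def by (auto intro: exI[of _ "Suc k" for k])

lemma face_minimal:
  assumes "d \<in> S" "\<And>x. x \<in> S \<Longrightarrow> fnext G x \<in> S"
  shows "face G d \<subseteq> S"
proof -
  have "(fnext G ^^ k) d \<in> S" for k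
    by (induction k) (use assms in auto)
  then show ?thesis
    by (auto simp: face_def)
qed

locale embedded =
  fixes G :: "'a cpt"
  assumes emb: "comb_plane_embedding G"
begin

lemma finite_cV: "finite (cV G)"
  using emb by (simp add: comb_plane_embedding_def)

lemma edgeD:
  assumes "{u, v} \<in> cE G"
  shows "u \<noteq> v" "u \<in> cV G" "v \<in> cV G"
proof -
  obtain x y where "x \<noteq> y" "x \<in> cV G" "y \<in> cV G" "{u, v} = {x, y}"
    using emb assms unfolding comb_plane_embedding_def by metis
  then show "u \<noteq> v" "u \<in> cV G" "v \<in> cV G"
    by (auto simp: doubleton_eq_iff)
qed

lemma dartD:
  assumes "(u, v) \<in> darts G"
  shows "u \<noteq> v" "u \<in> cV G" "v \<in> cV G"
  using assms edgeD by (auto simp: darts_def)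

lemma edge_is_pair: "e \<in> cE G \<Longrightarrow> \<exists>u v. e = {u, v} \<and> (u, v) \<in> darts G"
  using emb unfolding comb_plane_embedding_def darts_def by fastforce

lemma finite_darts: "finite (darts G)"
  by (rule finite_subset[of _ "cV G \<times> cV G"]) (use dartD finite_cV in auto)

lemma crot_nondart: "(u, v) \<notin> darts G \<Longrightarrow> crot G v u = u"
  using emb by (simp add: comb_plane_embedding_def nbrs_iff_darts)

text \<open>\<open>crot G v\<close> permutes the neighbours of \<open>v\<close> and is the identity
  elsewhere, so \<open>fnext G\<close> is injective on all pairs and not only on darts. Finite
  orbits are therefore periodic.\<close>

lemma inj_fnext: "inj (fnext G)"
proof (rule injI)
  fix d e assume *: "fnext G d = fnext G e"
  obtain u v where d: "d = (u, v)" by (cases d)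
  obtain w where e: "e = (w, v)" using * d by (cases e) (auto simp: fnext_def)
  have eq: "crot G v u = crot G v w" using * d e by (simp add: fnext_def)
  have bij: "bij_betw (crot G v) (nbrs G v) (nbrs G v)"
    using emb by (simp add: comb_plane_embedding_def)
  have id: "x \<notin> nbrs G v \<Longrightarrow> crot G v x = x" for x
    using emb by (simp add: comb_plane_embedding_def)
  have im: "x \<in> nbrs G v \<Longrightarrow> crot G v x \<in> nbrs G v" for x
    using bij by (rule bij_betwE[THEN bspec])
  have "u = w"
    using bij eq id im by (metis bij_betw_imp_inj_on inj_onD)
  then show "d = e" using d e by simp
qed

lemma fnext_dart: "d \<in> darts G \<Longrightarrow> fnext G d \<in> darts G"
proof -
  assume d: "d \<in> darts G"
  obtain u v where uv: "d = (u, v)" by (cases d)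
  have bij: "bij_betw (crot G v) (nbrs G v) (nbrs G v)"
    using emb by (simp add: comb_plane_embedding_def)
  have "crot G v u \<in> nbrs G v"
    using bij_betwE[OF bij] d uv by (simp add: nbrs_iff_darts)
  then show ?thesis
    using uv darts_sym[of v "crot G v u" G] by (simp add: nbrs_iff_darts fnext_def)
qed

lemma face_subset: "d \<in> darts G \<Longrightarrow> face G d \<subseteq> darts G"
  by (rule face_minimal) (auto intro: fnext_dart)

lemma finite_face: "d \<in> darts G \<Longrightarrow> finite (face G d)"
  using face_subset finite_darts finite_subset by blast

section \<open>Faces partition the darts\<close>

text \<open>A finite forward orbit of an injective map is periodic, so \<open>d\<close> can be
  reached again from each of its iterates.\<close>

lemma face_eq:
  assumes d: "d \<in> darts G" and x: "x \<in> face G d"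
  shows "face G x = face G d"
proof
  show "face G x \<subseteq> face G d"
    by (rule face_minimal) (auto intro: fnext_in_face x)
  have "finite {y. \<exists>n. y = (fnext G ^^ n) d}"
    using finite_face[OF d] by (simp add: face_def)
  then obtain n where n: "n > 0" "(fnext G ^^ n) d = d"
    using funpow_inj_finite[OF inj_fnext] by metis
  obtain k where k: "x = (fnext G ^^ k) d" using x by (auto simp: face_def)
  have period: "(fnext G ^^ (n * m)) d = d" for m
    by (induction m) (simp_all add: funpow_add n)
  \<comment> \<open>Since \<open>n > 0\<close>, the multiple \<open>n * k\<close> of the period is
    at least \<open>k\<close>, and \<open>n * k - k\<close> further steps lead from \<open>x\<close>
    back to \<open>d\<close>.\<close>
  have "k \<le> n * k" using n by simp
  then have "(fnext G ^^ (n * k - k)) x = (fnext G ^^ (n * k)) d"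
    using k funpow_add[of "n * k - k" k "fnext G"] by simp
  then have "d \<in> face G x" using period by (auto simp: face_def)
  then show "face G d \<subseteq> face G x"
    by (rule face_minimal) (auto intro: fnext_in_face)
qed

lemma in_faceD:
  assumes "f \<in> faces G" "d \<in> f"
  shows "f = face G d" "d \<in> darts G"
proof -
  obtain e where e: "e \<in> darts G" "f = face G e" using assms by (auto simp: faces_def)
  show "f = face G d" using face_eq[OF e(1)] e assms by simp
  show "d \<in> darts G" using face_subset[OF e(1)] e assms by blast
qed

lemma faces_disjoint: "f \<in> faces G \<Longrightarrow> g \<in> faces G \<Longrightarrow> f \<noteq> g \<Longrightarrow> f \<inter> g = {}"
  using in_faceD(1) by blast

lemma Union_faces: "\<Union>(faces G) = darts G"
  unfolding faces_def using face_subset self_in_face by blast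

lemma face_in_faces: "d \<in> darts G \<Longrightarrow> face G d \<in> faces G"
  by (simp add: faces_def)

lemma finite_faces: "finite (faces G)"
  by (simp add: faces_def finite_darts)

lemma finite_faceD: "f \<in> faces G \<Longrightarrow> finite f"
  using finite_face by (auto simp: faces_def)

lemma sum_faces:
  "(\<Sum>f\<in>faces G. card {d\<in>f. P d}) = card {d\<in>darts G. P d}"
proof -
  have "{d\<in>darts G. P d} = (\<Union>f\<in>faces G. {d\<in>f. P d})"
    using Union_faces by blast
  then show ?thesis
    using faces_disjoint finite_faces finite_faceD
    by (simp, subst card_UN_disjoint) auto
qed

text \<open>A face is determined by any of its darts. This turns the condition of
  \<open>flip4\<close> on unchanged faces into an equality between sets of darts.\<close>

lemma darts_outside_faces:
  assumes "d \<in> darts G" "e \<in> darts G"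
  shows "darts G - (face G d \<union> face G e) = \<Union>{f\<in>faces G. d \<notin> f \<and> e \<notin> f}"
proof (intro set_eqI iffI)
  fix x assume x: "x \<in> darts G - (face G d \<union> face G e)"
  then have "d \<notin> face G x" "e \<notin> face G x"
    using face_eq self_in_face by blast+
  then show "x \<in> \<Union>{f\<in>faces G. d \<notin> f \<and> e \<notin> f}"
    using x face_in_faces self_in_face by blast
next
  fix x assume "x \<in> \<Union>{f\<in>faces G. d \<notin> f \<and> e \<notin> f}"
  then obtain f where f: "f \<in> faces G" "d \<notin> f" "e \<notin> f" "x \<in> f" by auto
  then have fx: "f = face G x" "x \<in> darts G" using in_faceD by auto
  have "x \<notin> face G d" "x \<notin> face G e"
    using face_eq self_in_face f fx assms by metis+
  then show "x \<in> darts G - (face G d \<union> face G e)" using fx by simp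
qed

lemma card_darts: "card (darts G) = 2 * card (cE G)"
proof -
  have fin: "finite (cE G)"
    by (rule finite_subset[of _ "Pow (cV G)"]) (use edge_is_pair dartD finite_cV in fastforce)+
  have "darts G = (\<Union>e\<in>cE G. {(u, v). {u, v} = e})"
    by (auto simp: darts_def)
  moreover have c: "card {(u, v). {u, v} = e} = 2" if "e \<in> cE G" for e
  proof -
    obtain x y where "e = {x, y}" "x \<noteq> y" using edge_is_pair[OF \<open>e \<in> cE G\<close>] dartD by blast
    then have "{(u, v). {u, v} = e} = {(x, y), (y, x)}"
      by (auto simp: doubleton_eq_iff)
    then show ?thesis using \<open>x \<noteq> y\<close> by simp
  qed
  moreover have "finite {(u, v). {u, v} = e}" if "e \<in> cE G" for e
    using c[OF that] by (simp add: card_ge_0_finite)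
  ultimately show ?thesis
    using fin by (simp, subst card_UN_disjoint) auto
qed

text \<open>Three consecutive darts exhaust the face, so the third iterate of \<open>fnext\<close>
  returns to the start; matching heads with tails yields the third vertex.\<close>

lemma triangle_closes:
  assumes d: "(u, v) \<in> darts G" and c: "card (face G (u, v)) = 3"
  obtains w where "(v, w) \<in> face G (u, v)" "(w, u) \<in> face G (u, v)" "w \<noteq> u" "w \<noteq> v"
    "face G (u, v) = {(u, v), (v, w), (w, u)}"
proof -
  let ?f = "fnext G" and ?d = "(u, v)"
  have ne: "?f x \<noteq> x" if "x \<in> darts G" for x
    using that dartD[of "fst x" "snd x"] by (auto simp: fnext_def prod_eq_iff)
  have d1: "?f ?d \<in> darts G" and d2: "?f (?f ?d) \<in> darts G"
    using d fnext_dart by auto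
  have in1: "?f ?d \<in> face G ?d" and in2: "?f (?f ?d) \<in> face G ?d" and in3: "?f (?f (?f ?d)) \<in> face G ?d"
    using self_in_face fnext_in_face by metis+
  \<comment> \<open>Otherwise the orbit would have at most two elements.\<close>
  have ne2: "?f (?f ?d) \<noteq> ?d"
  proof
    assume eq: "?f (?f ?d) = ?d"
    have "face G ?d \<subseteq> {?d, ?f ?d}"
      by (rule face_minimal) (use eq in auto)
    then have "card (face G ?d) \<le> card {?d, ?f ?d}" by (intro card_mono) auto
    then show False using c by (simp add: card_insert_if split: if_splits)
  qed
  have F: "face G ?d = {?d, ?f ?d, ?f (?f ?d)}"
  proof (rule card_subset_eq[symmetric])
    show "card {?d, ?f ?d, ?f (?f ?d)} = card (face G ?d)"
      using ne[OF d] ne[OF d1] ne2 c by (auto simp: card_insert_if)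
  qed (use finite_face[OF d] in1 in2 self_in_face in auto)
  \<comment> \<open>Injectivity strips one application of \<open>fnext\<close> from both sides, so
    the third iterate can only be the first dart.\<close>
  have "?f (?f (?f ?d)) \<noteq> ?f ?d" "?f (?f (?f ?d)) \<noteq> ?f (?f ?d)"
    using ne2 ne[OF d1] inj_fnext[THEN injD] by metis+
  then have 3: "?f (?f (?f ?d)) = ?d" using in3 F by auto
  define w where "w = crot G v u"
  have w1: "?f ?d = (v, w)" by (simp add: fnext_def w_def)
  have w2: "?f (v, w) = (w, u)" using 3 w1 by (auto simp: fnext_def)
  show ?thesis
    by (rule that) (use w1 w2 in1 in2 F d1 d2 dartD in auto)
qed

end

lemma embedded_cppt4: "cppt4 G \<Longrightarrow> embedded G"
  by (simp add: cppt4_def comb_pt_def embedded_def)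

lemma reflex_dart:
  assumes "cppt4 G" "creflex G d"
  shows "d \<in> darts G"
proof -
  have "\<forall>d. creflex G d \<longrightarrow> d \<in> darts G"
    using assms(1) unfolding cppt4_def comb_pt_def by (elim conjE)
  then show ?thesis using assms(2) by blast
qed

section \<open>Flips are local\<close>

text \<open>\<open>W\<close> is any vertex set covering the two faces at the deleted edge. Keeping
  it arbitrary allows a later choice that does not depend on which edge is flipped.\<close>

lemma flip_locality:
  assumes flip: "flip4 G G'"
  obtains a b where "(a, b) \<in> darts G" "face G (a, b) \<noteq> couter G" "card (face G (a, b)) = 3"
    "\<And>W. face G (a, b) \<union> face G (b, a) \<subseteq> W \<times> W \<Longrightarrow>
      (\<forall>d. (d \<in> darts G' \<longleftrightarrow> d \<in> darts G) \<or> d \<in> W \<times> W) \<and>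
      (\<forall>u v. crot G' v u = crot G v u \<or> u \<in> W \<and> v \<in> W \<and> crot G' v u \<in> W) \<and>
      (\<forall>d. creflex G' d = creflex G d \<or> d \<in> W \<times> W)"
proof -
  obtain a b a' b' where
    pt: "cppt4 G" "cppt4 G'" and
    ab: "{a, b} \<in> cE G" "face G (a, b) \<noteq> couter G" "card (face G (a, b)) = 3" and
    new: "{a', b'} \<notin> cE G" and
    E': "cE G' = (cE G - {{a, b}}) \<union> {{a', b'}}" and
    rot: "\<forall>(v, u)\<in>darts G - {(a, b), (b, a)}.
            del_rot (crot G) a b v u = del_rot (crot G') a' b' v u" and
    same: "{f\<in>faces G'. (a', b') \<notin> f \<and> (b', a') \<notin> f} =
          {f\<in>faces G. (a, b) \<notin> f \<and> (b, a) \<notin> f}" and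
    tri: "card (face G' (a', b')) = 3 \<or> card (face G' (b', a')) = 3" and
    refl: "\<forall>d\<in>darts G'. d \<notin> face G' (a', b') \<union> face G' (b', a') \<longrightarrow>
            creflex G' d = creflex G d"
    using flip unfolding flip4_def
    by (elim exE conjE, intro that) (assumption | blast)+
  interpret G: embedded G using pt embedded_cppt4 by auto
  interpret G': embedded G' using pt embedded_cppt4 by auto
  let ?R = "face G (a, b) \<union> face G (b, a)" and ?R' = "face G' (a', b') \<union> face G' (b', a')"
  have dab: "(a, b) \<in> darts G" "(b, a) \<in> darts G"
    using ab by (auto simp: darts_def insert_commute)
  have dab': "(a', b') \<in> darts G'" "(b', a') \<in> darts G'"
    using E' by (auto simp: darts_def insert_commute)
  have D': "darts G' = (darts G - {(a, b), (b, a)}) \<union> {(a', b'), (b', a')}"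
    by (auto simp: darts_def E' doubleton_eq_iff)
  \<comment> \<open>The faces away from the old and the new edge coincide, hence so do the darts
    outside the old and the new region.\<close>
  have out: "darts G' - ?R' = darts G - ?R"
    using G.darts_outside_faces[OF dab] G'.darts_outside_faces[OF dab'] same by simp
  have old_R: "(a, b) \<in> ?R" "(b, a) \<in> ?R" using self_in_face by blast+
  \<comment> \<open>Apart from the new edge, a dart of the new region is an old dart, and
    \<open>out\<close> forces it into the old region.\<close>
  have R'_sub: "x \<in> ?R" if "x \<in> ?R'" "x \<noteq> (a', b')" "x \<noteq> (b', a')" for x
  proof -
    have "x \<in> darts G'" using that G'.face_subset dab' by blast
    then have "x \<in> darts G" using D' that by auto
    then show ?thesis using out that by blast
  qed
  have loc: "(\<forall>d. (d \<in> darts G' \<longleftrightarrow> d \<in> darts G) \<or> d \<in> W \<times> W) \<and>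
      (\<forall>u v. crot G' v u = crot G v u \<or> u \<in> W \<and> v \<in> W \<and> crot G' v u \<in> W) \<and>
      (\<forall>d. creflex G' d = creflex G d \<or> d \<in> W \<times> W)" if W: "?R \<subseteq> W \<times> W" for W
  proof -
    have abW: "a \<in> W" "b \<in> W" using W old_R by blast+
    \<comment> \<open>The triangle at the new edge has a third vertex, so both ends of the new edge
      already lie on darts of the merged region.\<close>
    have ends: "x \<in> W \<and> y \<in> W"
      if xy: "(x, y) \<in> darts G'" "card (face G' (x, y)) = 3" "face G' (x, y) \<subseteq> ?R'"
        "{x, y} = {a', b'}" for x y
    proof -
      obtain w where w: "(y, w) \<in> face G' (x, y)" "(w, x) \<in> face G' (x, y)" "w \<noteq> x" "w \<noteq> y"
        using G'.triangle_closes xy by metis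
      have "(y, w) \<in> ?R"
        by (rule R'_sub) (use w xy in \<open>auto simp: doubleton_eq_iff\<close>)
      moreover have "(w, x) \<in> ?R"
        by (rule R'_sub) (use w xy in \<open>auto simp: doubleton_eq_iff\<close>)
      ultimately show ?thesis using W by blast
    qed
    have ab'W: "a' \<in> W" "b' \<in> W"
      using tri ends[of a' b'] ends[of b' a'] dab' by auto
    have R'W: "?R' \<subseteq> W \<times> W"
    proof
      fix d assume "d \<in> ?R'"
      then show "d \<in> W \<times> W"
        using R'_sub[of d] W ab'W by (cases "d \<in> {(a', b'), (b', a')}") auto
    qed
    have 1: "(d \<in> darts G' \<longleftrightarrow> d \<in> darts G) \<or> d \<in> W \<times> W" for d
      using D' abW ab'W by auto
    have 3: "creflex G' d = creflex G d \<or> d \<in> W \<times> W" for d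
    proof (cases "d \<in> ?R'")
      case True
      then show ?thesis using R'W by blast
    next
      case notR: False
      show ?thesis
      proof (cases "d \<in> darts G'")
        case True
        then show ?thesis using refl notR by simp
      next
        case False
        \<comment> \<open>Pairs that are not darts carry no reflex tag. Thus the tags at
          \<open>d\<close> can differ only if \<open>d\<close> is a dart of \<open>G\<close> alone,
          and then it lies in \<open>W \<times> W\<close>.\<close>
        then have "\<not> creflex G' d" using reflex_dart[OF pt(2)] by blast
        then show ?thesis using False 1[of d] reflex_dart[OF pt(1), of d] by auto
      qed
    qed
    have 2: "crot G' v u = crot G v u \<or> u \<in> W \<and> v \<in> W \<and> crot G' v u \<in> W" for u v
    proof (cases "(u, v) \<in> ?R'")
      case True
      then have "fnext G' (u, v) \<in> ?R'" using fnext_in_face by blast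
      then have "crot G' v u \<in> W" using R'W by (auto simp: fnext_def)
      then show ?thesis using True R'W by blast
    next
      case False
      show ?thesis
      proof (cases "(u, v) \<in> darts G'")
        case True
        then have uv: "(u, v) \<in> darts G" "(u, v) \<notin> ?R" using out False by blast+
        \<comment> \<open>\<open>del_rot\<close> alters the rotation at \<open>(u, v)\<close> only
          if the next dart belongs to the deleted edge. That would put \<open>(u, v)\<close> on a
          face of the merged region, so here \<open>del_rot\<close> agrees with \<open>crot\<close>,
          in \<open>G\<close> and likewise in \<open>G'\<close>.\<close>
        have "face G (a, b) = face G (u, v)" if "(a, b) = fnext G (u, v)"
          using that G.face_eq[OF uv(1)] fnext_in_face[OF self_in_face] by metis
        moreover have "face G (b, a) = face G (u, v)" if "(b, a) = fnext G (u, v)"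
          using that G.face_eq[OF uv(1)] fnext_in_face[OF self_in_face] by metis
        ultimately have "fnext G (u, v) \<notin> {(a, b), (b, a)}"
          using uv self_in_face by (metis UnI1 UnI2 insertE singletonD)
        then have r: "del_rot (crot G) a b v u = crot G v u"
          by (auto simp: del_rot_def fnext_def)
        have "face G' (a', b') = face G' (u, v)" if "(a', b') = fnext G' (u, v)"
          using that G'.face_eq[OF True] fnext_in_face[OF self_in_face] by metis
        moreover have "face G' (b', a') = face G' (u, v)" if "(b', a') = fnext G' (u, v)"
          using that G'.face_eq[OF True] fnext_in_face[OF self_in_face] by metis
        ultimately have "fnext G' (u, v) \<notin> {(a', b'), (b', a')}"
          using False self_in_face by (metis UnI1 UnI2 insertE singletonD)
        then have r': "del_rot (crot G') a' b' v u = crot G' v u"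
          by (auto simp: del_rot_def fnext_def)
        \<comment> \<open>The rotation condition is indexed by the reversed pair, which is a dart by
          symmetry.\<close>
        have "(v, u) \<in> darts G - {(a, b), (b, a)}"
          using uv old_R darts_sym[of u v G] by auto
        from bspec[OF rot this] show ?thesis using r r' by simp
      next
        case F: False
        show ?thesis
        proof (cases "(u, v) \<in> darts G")
          case True
          then have "u \<in> W" "v \<in> W" using F 1[of "(u, v)"] by auto
          then show ?thesis using G'.crot_nondart[OF F] by simp
        next
          case False
          then show ?thesis using F G.crot_nondart G'.crot_nondart by simp
        qed
      qed
    qed
    show ?thesis using 1 2 3 by blast
  qed
  show ?thesis
    by (rule that[OF dab(1) ab(2,3)]) (rule loc)
qed

section \<open>Bounding the number of flips\<close>

text \<open>Double counting of the angles together with Euler's formula.\<close>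

lemma card_interior_triangles:
  fixes G :: "'a cpt"
  assumes pt: "cppt4 G" and outer: "card (couter G) = 3"
  shows "card {f\<in>faces G. f \<noteq> couter G \<and> card f = 3} = 1"
proof -
  interpret embedded G using pt embedded_cppt4 by auto
  let ?I = "faces G - {couter G}"
  have pt': "comb_pt G" "pointed G"
    and size: "f \<in> ?I \<Longrightarrow> card f = 3 \<or> card f = 4" for f
    using pt by (auto simp: cppt4_def)
  have convex: "f \<in> ?I \<Longrightarrow> card {d\<in>f. \<not> creflex G d} = 3" for f
    using pt' by (simp add: comb_pt_def)
  have outer_reflex: "{d\<in>couter G. \<not> creflex G d} = {}"
    using pt' by (auto simp: comb_pt_def)
  have couter: "couter G \<in> faces G"
    and euler: "int (card (cV G)) - int (card (cE G)) + int (card (faces G)) = 2"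
    using emb by (simp_all add: comb_plane_embedding_def)
  have split: "(\<Sum>f\<in>faces G. g f) = g (couter G) + (\<Sum>f\<in>?I. g f)" for g :: "_ \<Rightarrow> nat"
    using couter finite_faces by (rule sum.remove[rotated])
  \<comment> \<open>The reflex angles are counted by vertices, one each by pointedness; the convex
    ones are counted by faces, three in each interior face.\<close>
  have "{d\<in>darts G. creflex G d} = (\<Union>v\<in>cV G. {d\<in>darts G. snd d = v \<and> creflex G d})"
    using dartD by auto
  then have "card {d\<in>darts G. creflex G d} = (\<Sum>v\<in>cV G. card {d\<in>darts G. snd d = v \<and> creflex G d})"
    using finite_cV finite_darts by (simp, subst card_UN_disjoint) auto
  also have "\<dots> = card (cV G)"
    using pt' by (simp add: pointed_def)
  finally have r: "card {d\<in>darts G. creflex G d} = card (cV G)" .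
  have c: "card {d\<in>darts G. \<not> creflex G d} = 3 * card ?I"
    using sum_faces[of "\<lambda>d. \<not> creflex G d"] split[of "\<lambda>f. card {d\<in>f. \<not> creflex G d}"]
      convex outer_reflex by simp
  have "darts G = {d\<in>darts G. creflex G d} \<union> {d\<in>darts G. \<not> creflex G d}"
    by auto
  then have "card (darts G) = card ({d\<in>darts G. creflex G d} \<union> {d\<in>darts G. \<not> creflex G d})"
    by simp
  also have "\<dots> = card {d\<in>darts G. creflex G d} + card {d\<in>darts G. \<not> creflex G d}"
    using finite_darts by (intro card_Un_disjoint) auto
  finally have rc: "card (darts G) = card (cV G) + 3 * card ?I"
    using r c by simp
  have F: "card (faces G) = Suc (card ?I)"
    using couter finite_faces by (metis card.remove)
  have s: "card (darts G) = 3 + (\<Sum>f\<in>?I. card f)"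
    using sum_faces[of "\<lambda>_. True"] split[of card] outer by simp
  have "(\<Sum>f\<in>?I. card f) + (\<Sum>f\<in>?I. if card f = 3 then 1 else 0) = (\<Sum>f\<in>?I. 4)"
    unfolding sum.distrib[symmetric] by (rule sum.cong) (use size in auto)
  moreover have "(\<Sum>f\<in>?I. if card f = 3 then 1 else 0) = card {f\<in>?I. card f = 3}"
    using finite_faces by (simp add: sum.If_cases Int_def)
  moreover have "{f\<in>?I. card f = 3} = {f\<in>faces G. f \<noteq> couter G \<and> card f = 3}"
    by auto
  \<comment> \<open>Let V, I and t be the numbers of vertices, interior faces and interior
    triangles. Counting darts in two ways gives V + 3I = 3 + 4I - t. As V + 3I is twice the number
    of edges, Euler's formula gives V = I + 2, hence t = 1.\<close>
  ultimately show ?thesis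
    using euler rc F s card_darts by simp
qed

section \<open>The vertices that a flip can affect\<close>

text \<open>It collects the vertices of all regions that could be merged by a flip of
  \<open>G\<close>, so it depends on \<open>G\<close> alone. The face of \<open>prod.swap d\<close>
  lies across the edge of \<open>d\<close>.\<close>

definition flip_vertices :: "'a cpt \<Rightarrow> 'a set" where
  "flip_vertices G =
    (let R = \<Union>d\<in>\<Union>{f\<in>faces G. f \<noteq> couter G \<and> card f = 3}. face G d \<union> face G (prod.swap d)
     in fst ` R \<union> snd ` R)"

text \<open>The single interior triangle has 3 darts, each contributing two faces with at most 4
  darts. This makes at most 24 darts, each with two ends.\<close>

lemma card_flip_vertices:
  fixes G :: "'a cpt"
  assumes pt: "cppt4 G" and outer: "card (couter G) = 3"
  shows "finite (flip_vertices G)" "card (flip_vertices G) \<le> 48"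
proof -
  interpret embedded G using pt embedded_cppt4 by auto
  define R where
    "R = (\<Union>d\<in>\<Union>{f\<in>faces G. f \<noteq> couter G \<and> card f = 3}. face G d \<union> face G (prod.swap d))"
  have face4: "card (face G d) \<le> 4" if "d \<in> darts G" for d
  proof -
    have "card f \<le> 4" if "f \<in> faces G" for f
      using pt outer that by (cases "f = couter G") (auto simp: cppt4_def)
    then show ?thesis using face_in_faces that by auto
  qed
  obtain t where t: "{f\<in>faces G. f \<noteq> couter G \<and> card f = 3} = {t}"
    using card_interior_triangles[OF assms] by (auto simp: card_1_singleton_iff)
  then have t': "t \<in> faces G" "card t = 3" "finite t"
    using finite_faceD by auto
  have sw: "d \<in> darts G" "prod.swap d \<in> darts G" if "d \<in> t" for d
    using in_faceD(2)[OF t'(1) that] darts_sym[of "fst d" "snd d" G] by (simp_all add: prod.swap_def)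
  have fin: "finite R"
    unfolding R_def t using t' finite_face sw by auto
  have "card R \<le> (\<Sum>d\<in>t. card (face G d \<union> face G (prod.swap d)))"
    unfolding R_def t using card_UN_le[OF t'(3)] by simp
  also have "\<dots> \<le> (\<Sum>d\<in>t. 8)"
  proof (rule sum_mono)
    fix d assume "d \<in> t"
    then show "card (face G d \<union> face G (prod.swap d)) \<le> 8"
      using card_Un_le[of "face G d" "face G (prod.swap d)"] face4[OF sw(1)] face4[OF sw(2)]
      by fastforce
  qed
  finally have R24: "card R \<le> 24" using t' by simp
  have W: "flip_vertices G = fst ` R \<union> snd ` R"
    by (simp add: flip_vertices_def R_def Let_def)
  show "finite (flip_vertices G)" using fin W by simp
  have "card (flip_vertices G) \<le> card (fst ` R) + card (snd ` R)"
    unfolding W by (rule card_Un_le)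
  also have "\<dots> \<le> card R + card R"
    by (intro add_mono card_image_le fin)
  finally show "card (flip_vertices G) \<le> 48" using R24 by simp
qed

lemma flip_changes:
  assumes flip: "flip4 G G'" and W: "W = flip_vertices G"
  shows "(d \<in> darts G' \<longleftrightarrow> d \<in> darts G) \<or> d \<in> W \<times> W"
    "crot G' v u = crot G v u \<or> u \<in> W \<and> v \<in> W \<and> crot G' v u \<in> W"
    "creflex G' d = creflex G d \<or> d \<in> W \<times> W"
proof -
  obtain a b where ab: "(a, b) \<in> darts G" "face G (a, b) \<noteq> couter G" "card (face G (a, b)) = 3"
    and loc: "\<And>W. face G (a, b) \<union> face G (b, a) \<subseteq> W \<times> W \<Longrightarrow>
      (\<forall>d. (d \<in> darts G' \<longleftrightarrow> d \<in> darts G) \<or> d \<in> W \<times> W) \<and>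
      (\<forall>u v. crot G' v u = crot G v u \<or> u \<in> W \<and> v \<in> W \<and> crot G' v u \<in> W) \<and>
      (\<forall>d. creflex G' d = creflex G d \<or> d \<in> W \<times> W)"
    using flip_locality[OF flip] by blast
  define R where
    "R = (\<Union>d\<in>\<Union>{f\<in>faces G. f \<noteq> couter G \<and> card f = 3}. face G d \<union> face G (prod.swap d))"
  have "(a, b) \<in> \<Union>{f\<in>faces G. f \<noteq> couter G \<and> card f = 3}"
    using ab self_in_face unfolding faces_def by blast
  then have "face G (a, b) \<union> face G (b, a) \<subseteq> R"
    unfolding R_def by force
  also have "R \<subseteq> W \<times> W"
    unfolding W flip_vertices_def R_def[symmetric] Let_def by force
  finally show "(d \<in> darts G' \<longleftrightarrow> d \<in> darts G) \<or> d \<in> W \<times> W"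
    "crot G' v u = crot G v u \<or> u \<in> W \<and> v \<in> W \<and> crot G' v u \<in> W"
    "creflex G' d = creflex G d \<or> d \<in> W \<times> W"
    using loc by blast+
qed

section \<open>Encoding a flip by its local data\<close>

text \<open>The rotation is stored as its graph restricted to \<open>W\<close>, so that all
  components range over power sets. Values leaving \<open>W\<close> are not stored; changed values
  always stay in \<open>W\<close>.\<close>

definition local_data :: "'a set \<Rightarrow> 'a cpt \<Rightarrow> ('a \<times> 'a) set \<times> ('a \<times> 'a \<times> 'a) set \<times> ('a \<times> 'a) set" where
  "local_data W G =
    (darts G \<inter> W \<times> W, {(u, v, w) \<in> W \<times> W \<times> W. crot G v u = w}, {d \<in> W \<times> W. creflex G d})"

lemma flipD:
  assumes "flip4 G G'"
  shows "cppt4 G'" "cV G' = cV G" "couter G' = couter G"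
  using assms unfolding flip4_def by - (elim exE conjE; assumption)+

text \<open>Whatever the local data omit is inherited from \<open>G\<close>, so two results of a
  flip with equal data agree everywhere.\<close>

lemma inj_on_local_data: "inj_on (local_data (flip_vertices G)) {G'. flip4 G G'}"
proof (rule inj_onI)
  fix H K :: "'a cpt"
  define W where "W = flip_vertices G"
  assume "H \<in> {G'. flip4 G G'}" "K \<in> {G'. flip4 G G'}"
    and "local_data (flip_vertices G) H = local_data (flip_vertices G) K"
  then have H: "flip4 G H" and K: "flip4 G K" and eq: "local_data W H = local_data W K"
    by (simp_all add: W_def)
  interpret H: embedded H using embedded_cppt4[OF flipD(1)[OF H]] .
  interpret K: embedded K using embedded_cppt4[OF flipD(1)[OF K]] .
  have eqs: "darts H \<inter> W \<times> W = darts K \<inter> W \<times> W"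
      "{(u, v, w) \<in> W \<times> W \<times> W. crot H v u = w} = {(u, v, w) \<in> W \<times> W \<times> W. crot K v u = w}"
      "{d \<in> W \<times> W. creflex H d} = {d \<in> W \<times> W. creflex K d}"
    using eq by (simp_all only: local_data_def prod.inject)
  note chH = flip_changes[OF H W_def] and chK = flip_changes[OF K W_def]
  have "cV H = cV K" "couter H = couter K"
    using flipD[OF H] flipD[OF K] by simp_all
  moreover have D: "darts H = darts K"
    using chH(1) chK(1) eqs(1) by blast
  moreover have "cE H = cE K"
  proof -
    have "cE X = (\<lambda>(u, v). {u, v}) ` darts X" if "embedded X" for X :: "'a cpt"
      using embedded.edge_is_pair[OF that] by (fastforce simp: darts_def)
    then show ?thesis using D H.embedded_axioms K.embedded_axioms by metis
  qed
  moreover have "crot H = crot K"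
  proof (intro ext)
    fix v u
    \<comment> \<open>If neither value differs from that of \<open>G\<close>, they are equal;
      otherwise one of them lies in \<open>W\<close> together with \<open>u\<close> and
      \<open>v\<close>, and the stored graphs decide.\<close>
    have "crot H v u = w \<longleftrightarrow> crot K v u = w" if "u \<in> W" "v \<in> W" "w \<in> W" for w
      using eqset_imp_iff[OF eqs(2), of "(u, v, w)"] that by simp
    then show "crot H v u = crot K v u"
      using chH(2)[of v u] chK(2)[of v u] by metis
  qed
  moreover have "creflex H = creflex K"
  proof
    fix d
    show "creflex H d = creflex K d"
      using chH(3)[of d] chK(3)[of d] eqs(3) by blast
  qed
  ultimately show "H = K" by (intro cpt.equality) auto
qed

text \<open>\<open>D\<close> counts the possible local data over 48 vertices, so it is independent
  of \<open>G\<close> and of its number of vertices. The bound \<open>2 \<le> D\<close> serves the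
  geometric sum below and makes \<open>ln D\<close> positive.\<close>

lemma flip_degree_bounded:
  "\<exists>D::nat. 2 \<le> D \<and> (\<forall>G::'a cpt. cppt4 G \<longrightarrow> card (couter G) = 3 \<longrightarrow>
     finite {G'. flip4 G G'} \<and> card {G'. flip4 G G'} \<le> D)"
proof -
  define s :: nat where "s = 48"
  define D :: nat where "D = 2 ^ (s * s) * (2 ^ (s * (s * s)) * 2 ^ (s * s))"
  have "finite {G'. flip4 G G'} \<and> card {G'. flip4 G G'} \<le> D"
    if "cppt4 G" "card (couter G) = 3" for G :: "'a cpt"
  proof -
    define W where "W = flip_vertices G"
    have W: "finite W" "card W \<le> s"
      using card_flip_vertices[OF that] by (auto simp: W_def s_def)
    let ?T = "Pow (W \<times> W) \<times> Pow (W \<times> W \<times> W) \<times> Pow (W \<times> W)"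
    have sub: "local_data W ` {G'. flip4 G G'} \<subseteq> ?T"
      by (auto simp: local_data_def)
    have fin: "finite ?T" using W by simp
    have inj: "inj_on (local_data W) {G'. flip4 G G'}"
      unfolding W_def by (rule inj_on_local_data)
    have "card {G'. flip4 G G'} \<le> card ?T"
      by (rule card_inj_on_le[OF inj sub fin])
    also have "\<dots> = 2 ^ (card W * card W) * (2 ^ (card W * (card W * card W)) * 2 ^ (card W * card W))"
      using W by (simp add: card_cartesian_product card_Pow)
    also have "\<dots> \<le> D"
      unfolding D_def using W by (intro mult_mono power_increasing) auto
    finally show ?thesis
      using inj_on_finite[OF inj sub fin] by simp
  qed
  moreover have "2 \<le> D"
  proof -
    have "(2::nat) ^ 1 \<le> 2 ^ (s * s + (s * (s * s) + s * s))"
      by (rule power_increasing) (auto simp: s_def)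
    then show ?thesis by (simp add: D_def power_add)
  qed
  ultimately show ?thesis by blast
qed

text \<open>Flips preserve the outer face, so the bound on the number of flips applies at every
  graph along a walk and multiplies at each step.\<close>

lemma flip_walks_bounded:
  fixes G :: "'a cpt"
  assumes D: "\<And>G::'a cpt. cppt4 G \<Longrightarrow> card (couter G) = 3 \<Longrightarrow>
      finite {G'. flip4 G G'} \<and> card {G'. flip4 G G'} \<le> D"
    and G: "cppt4 G" "card (couter G) = 3"
  shows "finite {G'. (flip4 ^^ k) G G'} \<and> card {G'. (flip4 ^^ k) G G'} \<le> D ^ k"
proof (induction k)
  case (Suc k)
  have inv: "cppt4 G' \<and> card (couter G') = 3" if "(flip4 ^^ m) G G'" for G' m
    using that G by (induction m arbitrary: G') (auto dest: flipD)
  let ?A = "{G'. (flip4 ^^ k) G G'}"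
  have nb: "finite {G'. flip4 H G'} \<and> card {G'. flip4 H G'} \<le> D" if "H \<in> ?A" for H
    using inv[of k H] D[of H] that by simp
  have step: "{G'. (flip4 ^^ Suc k) G G'} = (\<Union>H\<in>?A. {G'. flip4 H G'})"
    by auto
  have "card (\<Union>H\<in>?A. {G'. flip4 H G'}) \<le> (\<Sum>H\<in>?A. card {G'. flip4 H G'})"
    using Suc by (intro card_UN_le) simp
  also have "\<dots> \<le> (\<Sum>H\<in>?A. D)"
    using nb by (intro sum_mono) blast
  also have "\<dots> \<le> D ^ Suc k"
    using Suc by simp
  finally show ?case
    unfolding step using Suc nb by auto
qed simp

section \<open>A large family with a triangular outer face\<close>

text \<open>Every element has a predecessor along the enumeration, so \<open>f\<close> is onto
  \<open>N\<close>, and injective since \<open>N\<close> is finite. It is used to check the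
  rotations at the vertices.\<close>

lemma cyclic_enumeration:
  assumes step: "\<And>i. i < m \<Longrightarrow> f (g i) = g (Suc i)" and close: "f (g m) = g 0"
    and N: "N = g ` {..m}"
  shows "bij_betw f N N" "\<forall>u\<in>N. \<forall>w\<in>N. \<exists>k. (f ^^ k) u = w"
proof -
  have iter: "(f ^^ k) (g i) = g (i + k)" if "i + k \<le> m" for i k
    using that by (induction k) (auto simp: step)
  have "N \<subseteq> f ` N"
  proof
    fix x assume "x \<in> N"
    then obtain j where j: "j \<le> m" "x = g j" using N by auto
    then show "x \<in> f ` N"
    proof (cases j)
      case 0
      then show ?thesis using j N close[symmetric] by auto
    next
      case (Suc i)
      then have "x = f (g i)" "g i \<in> N" using j N step[of i] by auto
      then show ?thesis by blast
    qed
  qed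
  moreover have "f ` N \<subseteq> N"
  proof
    fix x assume "x \<in> f ` N"
    then obtain j where "j \<le> m" "x = f (g j)" using N by auto
    then show "x \<in> N"
      using N close step[of j] by (cases "j = m") auto
  qed
  ultimately show "bij_betw f N N"
    using N finite_surj_inj[of N f] by (auto simp: bij_betw_def)
  show "\<forall>u\<in>N. \<forall>w\<in>N. \<exists>k. (f ^^ k) u = w"
  proof (intro ballI)
    fix u w assume "u \<in> N" "w \<in> N"
    then obtain i j where ij: "i \<le> m" "j \<le> m" "u = g i" "w = g j" using N by auto
    \<comment> \<open>From \<open>g i\<close> it takes \<open>m - i\<close> steps to
      \<open>g m\<close>, one more to close up at \<open>g 0\<close>, and \<open>j\<close> more to
      \<open>g j\<close>.\<close>
    have "(f ^^ (j + Suc (m - i))) u = (f ^^ j) (f ((f ^^ (m - i)) (g i)))"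
      using ij by (simp only: funpow_add funpow.simps comp_apply)
    also have "\<dots> = w"
      using ij iter[of i "m - i"] iter[of 0 j] close by simp
    finally show "\<exists>k. (f ^^ k) u = w" by blast
  qed
qed

lemma face_3:
  assumes nx: "fnext G a = b" "fnext G b = c" "fnext G c = a" and x: "x \<in> {a, b, c}"
  shows "face G x = {a, b, c}"
proof
  show "face G x \<subseteq> {a, b, c}" by (rule face_minimal) (use nx x in auto)
  have "a \<in> face G x \<Longrightarrow> b \<in> face G x" "b \<in> face G x \<Longrightarrow> c \<in> face G x"
    "c \<in> face G x \<Longrightarrow> a \<in> face G x"
    using nx fnext_in_face by metis+
  then show "{a, b, c} \<subseteq> face G x" using self_in_face[of x G] x by auto
qed

lemma face_4:
  assumes nx: "fnext G a = b" "fnext G b = c" "fnext G c = d" "fnext G d = a"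
    and x: "x \<in> {a, b, c, d}"
  shows "face G x = {a, b, c, d}"
proof
  show "face G x \<subseteq> {a, b, c, d}" by (rule face_minimal) (use nx x in auto)
  have "a \<in> face G x \<Longrightarrow> b \<in> face G x" "b \<in> face G x \<Longrightarrow> c \<in> face G x"
    "c \<in> face G x \<Longrightarrow> d \<in> face G x" "d \<in> face G x \<Longrightarrow> a \<in> face G x"
    using nx fnext_in_face by metis+
  then show "{a, b, c, d} \<subseteq> face G x" using self_in_face[of x G] x by auto
qed

section \<open>The fan graphs and their rotations\<close>

text \<open>The edges do not depend on the permutation, which enters a fan only through its
  rotations.\<close>

definition fan_edges :: "nat \<Rightarrow> nat set set" where
  "fan_edges n = insert {0, 1} ((\<lambda>v. {0, v}) ` {2..<n} \<union> (\<lambda>v. {1, v}) ` {2..<n})"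

text \<open>The apexes 0 and 1 are adjacent to each other and to every other vertex.  The vertices
  \<open>p 2 = 2, p 3, \<dots>, p (n - 1)\<close> are nested: the interior faces are the quadrilaterals
  \<open>0, p i, 1, p (i - 1)\<close>, with the reflex angle at \<open>p i\<close>, and the triangle \<open>0, 1, p (n - 1)\<close>.\<close>

definition fan :: "nat \<Rightarrow> (nat \<Rightarrow> nat) \<Rightarrow> nat cpt" where
  "fan n p = \<lparr>cV = {..<n}, cE = fan_edges n,
     crot = (\<lambda>v u. if {u, v} \<notin> fan_edges n then u
       else if v = 0 then (if u = p (n - 1) then 1 else p (Suc (inv p u)))
       else if v = 1 then (if u = 0 then p (n - 1) else if u = 2 then 0 else p (inv p u - 1))
       else 1 - u),
     couter = {(1, 0), (0, 2), (2, 1)},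
     creflex = (\<lambda>d. d \<in> insert (1, 0) (insert (2, 1) ({0} \<times> {2..<n})))\<rparr>"

text \<open>The permutation fixes 0, 1 and 2: \<open>p 2 = 2\<close> keeps the outer triangle common
  to all fans, and \<open>p 1 = 1\<close> lets the rotation at 0 treat the apex 1 as position
  1.\<close>

locale fan_perm =
  fixes n :: nat and p :: "nat \<Rightarrow> nat"
  assumes n: "4 \<le> n" and p: "p permutes {3..<n}"
begin

lemma p_fixed [simp]: "p 0 = 0" "p (Suc 0) = 1" "p 2 = 2"
  using permutes_not_in[OF p] by simp_all

lemma p_eq_iff [simp]: "p i = p j \<longleftrightarrow> i = j"
  using permutes_inj[OF p] by (simp add: inj_eq)

lemma p_eq_fixed [simp]: "p i = 0 \<longleftrightarrow> i = 0" "p i = Suc 0 \<longleftrightarrow> i = 1" "p i = 2 \<longleftrightarrow> i = 2"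
    "0 = p i \<longleftrightarrow> i = 0" "Suc 0 = p i \<longleftrightarrow> i = 1" "2 = p i \<longleftrightarrow> i = 2"
  using p_eq_iff[of i 0] p_eq_iff[of i 1] p_eq_iff[of i 2] by (auto simp del: p_eq_iff)

lemma inv_p [simp]: "inv p (p i) = i"
  using permutes_inverses(2)[OF p] .

lemma inv_p_1 [simp]: "inv p (Suc 0) = 1"
  using inv_p[of 1] by simp

lemma p_image: "k \<le> 3 \<Longrightarrow> p ` {k..<n} = {k..<n}"
  by (rule permutes_image, rule permutes_subset[OF p]) auto

lemma p_range: "2 \<le> i \<Longrightarrow> i < n \<Longrightarrow> 2 \<le> p i \<and> p i < n"
  using p_image[of 2] by auto

lemma p_surj: "2 \<le> v \<Longrightarrow> v < n \<Longrightarrow> \<exists>i. 2 \<le> i \<and> i < n \<and> v = p i"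
proof -
  assume "2 \<le> v" "v < n"
  then have "v \<in> p ` {2..<n}" using p_image[of 2] by simp
  then show ?thesis by auto
qed

lemma edge_iff: "{u, v} \<in> fan_edges n \<longleftrightarrow>
    u = 0 \<and> v = 1 \<or> u = 1 \<and> v = 0 \<or> u \<le> 1 \<and> 2 \<le> v \<and> v < n \<or> v \<le> 1 \<and> 2 \<le> u \<and> u < n"
proof -
  have spoke: "{u, v} \<in> (\<lambda>w. {a, w}) ` S \<longleftrightarrow> u = a \<and> v \<in> S \<or> v = a \<and> u \<in> S" for a S
    by (force simp: image_iff doubleton_eq_iff)
  show ?thesis
    unfolding fan_edges_def insert_iff Un_iff spoke doubleton_eq_iff atLeastLessThan_iff by linarith
qed

lemma dart_iff: "(u, v) \<in> darts (fan n p) \<longleftrightarrow>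
    u = 0 \<and> v = 1 \<or> u = 1 \<and> v = 0 \<or> u \<le> 1 \<and> 2 \<le> v \<and> v < n \<or> v \<le> 1 \<and> 2 \<le> u \<and> u < n"
  using edge_iff by (simp add: darts_def fan_def)

text \<open>The rotation at 0 runs through 1, 2, \<open>p 3\<close>, ..., \<open>p (n - 1)\<close>
  and back to 1; position 1 is the apex 1. The rotation at 1 runs through the nested vertices in the
  opposite order.\<close>

lemma crot_0: "1 \<le> i \<Longrightarrow> i < n \<Longrightarrow> crot (fan n p) 0 (p i) = (if i = n - 1 then 1 else p (Suc i))"
  using n p_range[of i] by (cases "i = 1") (auto simp: fan_def edge_iff)

lemma crot_1_0: "crot (fan n p) (Suc 0) 0 = p (n - 1)"
  by (auto simp: fan_def edge_iff)

lemma crot_1: "2 \<le> i \<Longrightarrow> i < n \<Longrightarrow> crot (fan n p) (Suc 0) (p i) = (if i = 2 then 0 else p (i - 1))"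
  using p_range[of i] by (auto simp: fan_def edge_iff)

lemma crot_2: "2 \<le> v \<Longrightarrow> v < n \<Longrightarrow> crot (fan n p) v 0 = 1"
  "2 \<le> v \<Longrightarrow> v < n \<Longrightarrow> crot (fan n p) v (Suc 0) = 0"
  by (auto simp: fan_def edge_iff)

section \<open>The faces of a fan\<close>

definition "outer = {(1::nat, 0::nat), (0, 2), (2, 1)}"
definition "inner = {(0::nat, 1::nat), (1, p (n - 1)), (p (n - 1), 0)}"
definition "quad i = {(0::nat, p i), (p i, 1), (1, p (i - 1)), (p (i - 1), 0)}"

lemma fnext_fan:
  "fnext (fan n p) (0, Suc 0) = (1, p (n - 1))"
  "fnext (fan n p) (Suc 0, 0) = (0, 2)"
  "2 \<le> i \<Longrightarrow> i < n \<Longrightarrow> fnext (fan n p) (p i, 0) = (0, if i = n - 1 then 1 else p (Suc i))"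
  "2 \<le> i \<Longrightarrow> i < n \<Longrightarrow> fnext (fan n p) (p i, Suc 0) = (1, if i = 2 then 0 else p (i - 1))"
  "2 \<le> i \<Longrightarrow> i < n \<Longrightarrow> fnext (fan n p) (0, p i) = (p i, 1)"
  "2 \<le> i \<Longrightarrow> i < n \<Longrightarrow> fnext (fan n p) (Suc 0, p i) = (p i, 0)"
proof -
  have "crot (fan n p) 0 (Suc 0) = 2"
    using crot_0[of 1] n by (simp add: numeral_2_eq_2[symmetric])
  then show "fnext (fan n p) (Suc 0, 0) = (0, 2)" by (simp add: fnext_def)
qed (use p_range in \<open>auto simp: fnext_def crot_0 crot_1_0 crot_1 crot_2\<close>)

lemma fnext_2:
  "fnext (fan n p) (2, Suc 0) = (1, 0)"
  "fnext (fan n p) (0, 2) = (2, 1)"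
  using fnext_fan(4)[of 2] fnext_fan(5)[of 2] n by simp_all

lemma face_outer: "d \<in> outer \<Longrightarrow> face (fan n p) d = outer"
  unfolding outer_def by (rule face_3) (simp_all add: fnext_fan fnext_2)

lemma face_inner: "d \<in> inner \<Longrightarrow> face (fan n p) d = inner"
  unfolding inner_def by (rule face_3) (use n in \<open>simp_all add: fnext_fan\<close>)

lemma face_quad: "3 \<le> i \<Longrightarrow> i < n \<Longrightarrow> d \<in> quad i \<Longrightarrow> face (fan n p) d = quad i"
  unfolding quad_def by (rule face_4) (use fnext_fan(3)[of "i - 1"] in \<open>auto simp: fnext_fan\<close>)

text \<open>At \<open>p i\<close>, the darts \<open>(0, p i)\<close> and \<open>(p i, 1)\<close> lie
  on \<open>quad i\<close>, the reversed ones on \<open>quad (Suc i)\<close>. At the ends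
  \<open>i = 2\<close> and \<open>i = n - 1\<close> the faces \<open>outer\<close> and
  \<open>inner\<close> take over.\<close>

lemma darts_cover: "darts (fan n p) = outer \<union> inner \<union> (\<Union>i\<in>{3..<n}. quad i)"
proof
  show "outer \<union> inner \<union> (\<Union>i\<in>{3..<n}. quad i) \<subseteq> darts (fan n p)"
    using n p_range by (auto simp: outer_def inner_def quad_def dart_iff)
  define U where "U = (\<Union>i\<in>{3..<n}. quad i)"
  have spoke: "(0, p i) \<in> outer \<union> U" "(p i, 1) \<in> outer \<union> U"
    "(1, p i) \<in> inner \<union> U" "(p i, 0) \<in> inner \<union> U" if i: "2 \<le> i" "i < n" for i
  proof -
    have low: "i = 2 \<or> quad i \<subseteq> U" and high: "i = n - 1 \<or> quad (Suc i) \<subseteq> U"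
    proof -
      have "i = 2 \<or> i \<in> {3..<n}" "i = n - 1 \<or> Suc i \<in> {3..<n}" using i by auto
      then show "i = 2 \<or> quad i \<subseteq> U" "i = n - 1 \<or> quad (Suc i) \<subseteq> U"
        unfolding U_def by blast+
    qed
    show "(0, p i) \<in> outer \<union> U" "(p i, 1) \<in> outer \<union> U"
      using low by (auto simp: outer_def quad_def)
    show "(1, p i) \<in> inner \<union> U" "(p i, 0) \<in> inner \<union> U"
      using high by (auto simp: inner_def quad_def)
  qed
  show "darts (fan n p) \<subseteq> outer \<union> inner \<union> (\<Union>i\<in>{3..<n}. quad i)"
    unfolding U_def[symmetric]
  proof
    fix d assume d: "d \<in> darts (fan n p)"
    obtain u v where uv: "d = (u, v)" by (cases d)
    consider "d \<in> {(0, 1), (1, 0)}" | "u \<le> 1" "2 \<le> v" "v < n" | "v \<le> 1" "2 \<le> u" "u < n"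
      using d uv by (auto simp: dart_iff)
    then show "d \<in> outer \<union> inner \<union> U"
    proof cases
      case 1
      then show ?thesis by (auto simp: outer_def inner_def)
    next
      case 2
      then obtain i where i: "2 \<le> i" "i < n" "v = p i" using p_surj by blast
      have "u = 0 \<or> u = 1" using 2 by auto
      then show ?thesis using spoke[OF i(1,2)] uv i(3) by blast
    next
      case 3
      then obtain i where i: "2 \<le> i" "i < n" "u = p i" using p_surj by blast
      have "v = 0 \<or> v = 1" using 3 by auto
      then show ?thesis using spoke[OF i(1,2)] uv i(3) by blast
    qed
  qed
qed

lemma faces_fan: "faces (fan n p) = insert outer (insert inner (quad ` {3..<n}))"
proof
  show "faces (fan n p) \<subseteq> insert outer (insert inner (quad ` {3..<n}))"
    unfolding faces_def darts_cover using face_outer face_inner face_quad by auto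
  have "outer = face (fan n p) (1, 0)" "(1, 0) \<in> darts (fan n p)"
    using face_outer[of "(1, 0)"] by (simp_all add: outer_def dart_iff)
  moreover have "inner = face (fan n p) (0, 1)" "(0, 1) \<in> darts (fan n p)"
    using face_inner[of "(0, 1)"] by (simp_all add: inner_def dart_iff)
  moreover have "quad i = face (fan n p) (0, p i)" "(0, p i) \<in> darts (fan n p)"
    if "i \<in> {3..<n}" for i
    using that face_quad[of i "(0, p i)"] p_range[of i] by (auto simp: quad_def dart_iff)
  ultimately show "insert outer (insert inner (quad ` {3..<n})) \<subseteq> faces (fan n p)"
    unfolding faces_def by blast
qed

text \<open>There are \<open>n - 3\<close> quadrilaterals, told apart by their darts
  \<open>(0, p i)\<close>, and two triangles, told apart from the rest by the darts of the edge
  between 0 and 1.\<close>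

lemma card_faces_fan: "card (faces (fan n p)) = n - 1"
proof -
  have inj: "inj_on quad {3..<n}"
  proof (rule inj_onI)
    fix i j assume ij: "i \<in> {3..<n}" "j \<in> {3..<n}" and eq: "quad i = quad j"
    have "(0, p i) \<in> quad i" by (simp add: quad_def)
    then have "(0, p i) \<in> quad j" unfolding eq .
    then show "i = j" using ij by (auto simp: quad_def)
  qed
  have "(0, 1) \<in> inner" "(0, 1) \<notin> outer" "(1, 0) \<in> outer"
    by (auto simp: inner_def outer_def)
  moreover have "(0, 1) \<notin> quad i" "(1, 0) \<notin> quad i" if "i \<in> {3..<n}" for i
    using that by (auto simp: quad_def)
  ultimately have "outer \<notin> insert inner (quad ` {3..<n})" "inner \<notin> quad ` {3..<n}"
    by blast+
  then show ?thesis
    using inj n by (simp add: faces_fan card_image)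
qed

lemma card_fan_edges: "card (fan_edges n) = 2 * n - 3"
proof -
  let ?A = "(\<lambda>v::nat. {0, v}) ` {2..<n}" and ?B = "(\<lambda>v::nat. {1, v}) ` {2..<n}"
  have "card ?A = n - 2" "card ?B = n - 2"
    by (subst card_image; auto simp: inj_on_def doubleton_eq_iff)+
  moreover have "\<forall>e\<in>?A. 0 \<in> e \<and> 1 \<notin> e" "\<forall>e\<in>?B. 1 \<in> e \<and> 0 \<notin> e"
    by auto
  then have "?A \<inter> ?B = {}" "{0, 1} \<notin> ?A \<union> ?B"
    by blast+
  ultimately show ?thesis
    using n by (simp add: fan_edges_def card_Un_disjoint)
qed

section \<open>Fans are pointed pseudo-triangulations\<close>

lemma nbrs_fan:
  "nbrs (fan n p) 0 = {1..<n}"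
  "nbrs (fan n p) (Suc 0) = insert 0 {2..<n}"
  "2 \<le> v \<Longrightarrow> v < n \<Longrightarrow> nbrs (fan n p) v = {0, 1}"
  "n \<le> v \<Longrightarrow> nbrs (fan n p) v = {}"
  using n by (auto simp: nbrs_iff_darts dart_iff)

lemma crot_cyclic:
  "bij_betw (crot (fan n p) v) (nbrs (fan n p) v) (nbrs (fan n p) v) \<and>
   (\<forall>u\<in>nbrs (fan n p) v. \<forall>w\<in>nbrs (fan n p) v. \<exists>k. (crot (fan n p) v ^^ k) u = w)"
proof -
  consider "v = 0" | "v = 1" | "2 \<le> v" "v < n" | "n \<le> v" by linarith
  then show ?thesis
  proof cases
    case 1
    \<comment> \<open>The enumeration \<open>p 1, ..., p (n - 1)\<close> is shifted by one to start
      at index 0.\<close>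
    have "{1..<n} = {Suc 0..Suc (n - 2)}"
      using n by auto
    then have "{1..<n} = Suc ` {..n - 2}"
      by (simp add: image_Suc_atMost)
    then have N: "nbrs (fan n p) 0 = (\<lambda>i. p (Suc i)) ` {..n - 2}"
      using p_image[of 1] by (simp add: nbrs_fan image_image)
    show ?thesis
      unfolding 1 by (intro conjI; rule cyclic_enumeration[OF _ _ N]) (use n in \<open>auto simp: crot_0\<close>)
  next
    case 2
    \<comment> \<open>This is the rotation order at 1: first the apex 0, then
      \<open>p (n - 1)\<close> down to \<open>p 2\<close>.\<close>
    define g where "g = (\<lambda>i. if i = 0 then 0 else p (n - i))"
    have "nbrs (fan n p) 1 = insert 0 (p ` {2..<n})"
      using p_image[of 2] by (simp add: nbrs_fan)
    also have "{2..<n} = (\<lambda>i. n - i) ` {1..n - 2}"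
    proof (intro set_eqI iffI)
      fix x assume "x \<in> {2..<n}"
      then show "x \<in> (\<lambda>i. n - i) ` {1..n - 2}"
        by (intro image_eqI[of _ _ "n - x"]) auto
    qed auto
    also have "insert 0 (p ` (\<lambda>i. n - i) ` {1..n - 2}) = g ` insert 0 {1..n - 2}"
      by (auto simp: g_def image_iff)
    also have "insert 0 {1..n - 2} = {..n - 2}"
      by auto
    finally have N: "nbrs (fan n p) 1 = g ` {..n - 2}" .
    have step: "crot (fan n p) 1 (g i) = g (Suc i)" if "i < n - 2" for i
    proof (cases "i = 0")
      case False
      then show ?thesis using that crot_1[of "n - i"] by (simp add: g_def)
    qed (simp add: g_def crot_1_0)
    have "crot (fan n p) 1 (g (n - 2)) = g 0"
      using n crot_1[of 2] by (simp add: g_def)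
    then show ?thesis
      unfolding 2 using cyclic_enumeration[OF step _ N] by blast
  next
    case 3
    have N: "nbrs (fan n p) v = id ` {..Suc 0}"
      by (simp add: nbrs_fan(3)[OF 3] atMost_Suc insert_commute)
    show ?thesis
      by (intro conjI; rule cyclic_enumeration[OF _ _ N]) (use 3 in \<open>auto simp: crot_2\<close>)
  next
    case 4
    then show ?thesis by (simp add: nbrs_fan bij_betw_def)
  qed
qed

lemma fan_sel:
  "cV (fan n p) = {..<n}" "cE (fan n p) = fan_edges n" "couter (fan n p) = outer"
  "creflex (fan n p) d \<longleftrightarrow> d = (1, 0) \<or> d = (2, 1) \<or> fst d = 0 \<and> 2 \<le> snd d \<and> snd d < n"
  by (cases d; auto simp: fan_def outer_def)+

text \<open>Connectivity goes through the vertex 0, and Euler's formula reads n - (2n - 3) + (n - 1)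
  = 2.\<close>

lemma comb_plane_embedding_fan: "comb_plane_embedding (fan n p)"
proof -
  let ?E = "\<lambda>x y. {x, y} \<in> fan_edges n"
  have conn: "?E\<^sup>*\<^sup>* u 0 \<and> ?E\<^sup>*\<^sup>* 0 u" if "u < n" for u
  proof (cases "u = 0")
    case False
    then have "?E u 0" "?E 0 u" using that by (auto simp: edge_iff)
    then show ?thesis by (meson r_into_rtranclp)
  qed simp
  have "\<exists>x y. x \<noteq> y \<and> x < n \<and> y < n \<and> e = {x, y}" if e: "e \<in> fan_edges n" for e
  proof -
    consider "e = {0, 1}" | v where "e = {0, v}" "2 \<le> v" "v < n" | v where "e = {1, v}" "2 \<le> v" "v < n"
      using e by (auto simp: fan_edges_def)
    then show ?thesis
    proof cases
      case 1
      then show ?thesis using n by - (rule exI[of _ 0], rule exI[of _ 1], simp)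
    next
      case (2 v)
      then show ?thesis using n by - (rule exI[of _ 0], rule exI[of _ v], simp)
    next
      case (3 v)
      then show ?thesis using n by - (rule exI[of _ 1], rule exI[of _ v], simp)
    qed
  qed
  then have edges: "\<forall>e\<in>fan_edges n. \<exists>x y. x \<noteq> y \<and> x \<in> {..<n} \<and> y \<in> {..<n} \<and> e = {x, y}"
    by simp
  have connected: "\<forall>u\<in>{..<n}. \<forall>v\<in>{..<n}. ?E\<^sup>*\<^sup>* u v"
    using conn by (meson lessThan_iff rtranclp_trans)
  have fixed: "\<forall>v u. u \<notin> nbrs (fan n p) v \<longrightarrow> crot (fan n p) v u = u"
    by (simp add: nbrs_def fan_def insert_commute)
  have euler: "int (card {..<n}) - int (card (fan_edges n)) + int (card (faces (fan n p))) = 2"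
    using n by (simp add: card_fan_edges card_faces_fan of_nat_diff)
  show ?thesis
    unfolding comb_plane_embedding_def fan_sel
  proof (intro conjI edges connected fixed euler)
    show "outer \<in> faces (fan n p)" by (simp add: faces_fan)
  qed (use crot_cyclic in \<open>blast intro: finite_lessThan\<close>)+
qed

lemma reflex_unique:
  assumes "v < n"
  shows "card {d\<in>darts (fan n p). snd d = v \<and> creflex (fan n p) d} = 1"
proof -
  \<comment> \<open>The reflex angles at 0, 1 and 2 lie on the outer face; that at every other
    vertex \<open>p i\<close> lies on \<open>quad i\<close>.\<close>
  have "{d\<in>darts (fan n p). snd d = v \<and> creflex (fan n p) d} =
      {(if v = 0 then 1 else if v = 1 then 2 else 0, v)}"
    using assms n by (auto simp: dart_iff fan_sel)
  then show ?thesis by simp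
qed

lemma cppt4_fan: "cppt4 (fan n p)"
proof -
  have quad: "card (quad i) = 4" "card {d\<in>quad i. \<not> creflex (fan n p) d} = 3" if "i \<in> {3..<n}" for i
  proof -
    have i: "3 \<le> i" "i < n" using that by auto
    then have "{d\<in>quad i. \<not> creflex (fan n p) d} = {(p i, 1), (1, p (i - 1)), (p (i - 1), 0)}"
      using p_range[of i] p_range[of "i - 1"] by (auto simp: quad_def fan_sel)
    then show "card {d\<in>quad i. \<not> creflex (fan n p) d} = 3" "card (quad i) = 4"
      using i by (auto simp: quad_def card_insert_if)
  qed
  have "{d\<in>inner. \<not> creflex (fan n p) d} = inner"
    using n p_range[of "n - 1"] by (auto simp: inner_def fan_sel)
  moreover have "card inner = 3"
    using n by (auto simp: inner_def card_insert_if)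
  ultimately have inner: "card inner = 3" "card {d\<in>inner. \<not> creflex (fan n p) d} = 3"
    by simp_all
  have "creflex (fan n p) d \<Longrightarrow> d \<in> darts (fan n p)" for d
    using n by (cases d) (auto simp: fan_sel dart_iff)
  moreover have "\<forall>d\<in>outer. creflex (fan n p) d"
    using n by (auto simp: outer_def fan_sel)
  ultimately show ?thesis
    unfolding cppt4_def comb_pt_def pointed_def
    using comb_plane_embedding_fan quad inner reflex_unique faces_fan fan_sel by auto
qed

lemma p_recursion: "2 \<le> i \<Longrightarrow> Suc i < n \<Longrightarrow> p (Suc i) = crot (fan n p) 0 (p i)"
  using crot_0[of i] by auto

end

lemma card_couter_fan: "card (couter (fan n p)) = 3"
  by (simp add: fan_def)

text \<open>Following the rotation at 0 from the common vertex \<open>p 2 = 2\<close> recovers the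
  permutation.\<close>

lemma inj_on_fan:
  assumes n: "4 \<le> n"
  shows "inj_on (fan n) {p. p permutes {3..<n}}"
proof (rule inj_onI)
  fix p q assume "p \<in> {p. p permutes {3..<n}}" "q \<in> {p. p permutes {3..<n}}"
    and eq: "fan n p = fan n q"
  then have p: "p permutes {3..<n}" and q: "q permutes {3..<n}" by auto
  interpret p: fan_perm n p using n p by unfold_locales
  interpret q: fan_perm n q using n q by unfold_locales
  have "p i = q i" if "2 \<le> i" "i < n" for i
    using that
  proof (induction i rule: dec_induct)
    case (step i)
    then show ?case using p.p_recursion[of i] q.p_recursion[of i] eq by simp
  qed simp
  then have "p i = q i" for i
    using permutes_not_in[OF p, of i] permutes_not_in[OF q, of i] by (cases "i \<in> {3..<n}") auto
  then show "p = q" by blast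
qed

section \<open>Comparing the two counts\<close>

text \<open>A weak form of Stirling's formula. The induction step reduces to
  \<open>m * (ln (m + 1) - ln m) \<le> 1\<close>, which follows from
  \<open>ln (1 + 1 / m) \<le> 1 / m\<close>.\<close>

lemma ln_fact_ge: "real m * ln (real m) - real m \<le> ln (fact m)"
proof (induction m)
  case (Suc m)
  show ?case
  proof (cases "m = 0")
    case False
    have "1 + 1 / real m = (real m + 1) / real m"
      using False by (simp add: field_simps)
    then have "ln (real m + 1) - ln (real m) = ln (1 + 1 / real m)"
      using False by (simp add: ln_div)
    also have "\<dots> \<le> 1 / real m"
      by (rule ln_add_one_self_le_self) simp
    finally have "real m * (ln (real m + 1) - ln (real m)) \<le> 1"
      using False by (simp add: field_simps)
    moreover have "ln (fact (Suc m)) = ln (real m + 1) + ln (fact m)"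
      by (simp add: ln_mult add.commute)
    ultimately show ?thesis
      using Suc by (simp add: algebra_simps)
  qed simp
qed simp

lemma sum_powers_le:
  fixes D :: nat
  assumes "2 \<le> D"
  shows "(\<Sum>k<K. D ^ k) \<le> D ^ K"
proof (induction K)
  case (Suc K)
  have "(\<Sum>k<Suc K. D ^ k) \<le> 2 * D ^ K" using Suc by simp
  also have "\<dots> \<le> D ^ Suc K" using assms by simp
  finally show ?case .
qed simp

text \<open>If every fan were within fewer than \<open>x\<close> flips of \<open>fan n id\<close>,
  all \<open>(n - 3)!\<close> fans would be among the at most \<open>D ^ K\<close> graphs reached in
  fewer than \<open>K\<close> flips.\<close>

lemma exists_far_fan:
  fixes x :: real
  assumes n: "4 \<le> n"
    and D: "2 \<le> D" "\<And>G::nat cpt. cppt4 G \<Longrightarrow> card (couter G) = 3 \<Longrightarrow>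
      finite {G'. flip4 G G'} \<and> card {G'. flip4 G G'} \<le> D"
    and x: "0 \<le> x" "(x + 1) * ln (real D) < ln (fact (n - 3))"
  shows "\<exists>p. p permutes {3..<n} \<and> (\<forall>k. (flip4 ^^ k) (fan n id) (fan n p) \<longrightarrow> x \<le> real k)"
proof (rule ccontr)
  assume neg: "\<not> ?thesis"
  \<comment> \<open>A natural number below \<open>x\<close> is below \<open>K\<close>, while
    \<open>K \<le> x + 1\<close>; the latter explains the summand 1 in the hypothesis.\<close>
  define K where "K = nat \<lceil>x\<rceil>"
  let ?P = "{p. p permutes {3..<n}}"
  let ?A = "\<lambda>k. {G. (flip4 ^^ k) (fan n id) G}"
  interpret fan_perm n id using n by unfold_locales (auto intro: permutes_id)
  have A: "finite (?A k) \<and> card (?A k) \<le> D ^ k" for k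
    by (rule flip_walks_bounded[OF D(2) cppt4_fan card_couter_fan])
  have "fan n ` ?P \<subseteq> (\<Union>k<K. ?A k)"
  proof
    fix G assume "G \<in> fan n ` ?P"
    then obtain k where "(flip4 ^^ k) (fan n id) G" "real k < x"
      using neg by (auto simp: not_le)
    moreover from this have "k < K" unfolding K_def by linarith
    ultimately show "G \<in> (\<Union>k<K. ?A k)" by auto
  qed
  then have "card (fan n ` ?P) \<le> card (\<Union>k<K. ?A k)"
    using A by (intro card_mono) auto
  also have "\<dots> \<le> (\<Sum>k<K. card (?A k))"
    by (rule card_UN_le) simp
  also have "\<dots> \<le> (\<Sum>k<K. D ^ k)"
    using A by (intro sum_mono) auto
  also have "\<dots> \<le> D ^ K"
    by (rule sum_powers_le[OF D(1)])
  also have "card (fan n ` ?P) = fact (n - 3)"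
    using n by (simp add: card_image[OF inj_on_fan] card_permutations[OF refl])
  finally have "fact (n - 3) \<le> D ^ K" .
  then have "real (fact (n - 3)) \<le> real (D ^ K)"
    by (simp only: of_nat_le_iff)
  then have "ln (fact (n - 3)) \<le> ln (real D ^ K)"
    using D(1) by simp
  also have "\<dots> = real K * ln (real D)"
    using D(1) by (simp add: ln_realpow)
  also have "\<dots> \<le> (x + 1) * ln (real D)"
    using x(1) D(1) unfolding K_def by (intro mult_right_mono) (linarith, simp)
  finally show False using x(2) by simp
qed

theorem theorem5:
  shows "\<exists>c::real. c > 0 \<and> (\<exists>N::nat. \<forall>n\<ge>N. \<exists>T1 T2 :: nat cpt.
            cppt4 T1 \<and> cppt4 T2 \<and>
            cV T1 = cV T2 \<and> card (cV T1) = n \<and>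
            couter T1 = couter T2 \<and> (\<forall>d\<in>couter T1. fnext T1 d = fnext T2 d) \<and>
            (\<forall>k. (flip4 ^^ k) T1 T2 \<longrightarrow> c * real n * ln (real n) \<le> real k))"
proof -
  obtain D :: nat where D: "2 \<le> D" "\<And>G::nat cpt. cppt4 G \<Longrightarrow> card (couter G) = 3 \<Longrightarrow>
      finite {G'. flip4 G G'} \<and> card {G'. flip4 G G'} \<le> D"
    using flip_degree_bounded[where 'a=nat] by blast
  define L where "L = ln (real D)"
  have L: "L > 0" using D(1) by (simp add: L_def)
  \<comment> \<open>With this choice \<open>c * n * ln n * L\<close> is half of
    \<open>n ln n\<close>, whereas \<open>ln ((n - 3)!)\<close> is asymptotically
    \<open>n ln n\<close>; the gap absorbs all lower-order terms.\<close>
  define c where "c = 1 / (2 * L)"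
  have "\<forall>\<^sub>F n in sequentially. real n * ln (real n) / 2 + L
      < (real n - 3) * ln (real n - 3) - (real n - 3)"
    by real_asymp
  then obtain N where N: "\<And>n. n \<ge> N \<Longrightarrow> real n * ln (real n) / 2 + L
      < (real n - 3) * ln (real n - 3) - (real n - 3)"
    by (auto simp: eventually_sequentially)
  have "\<exists>T1 T2 :: nat cpt. cppt4 T1 \<and> cppt4 T2 \<and>
            cV T1 = cV T2 \<and> card (cV T1) = n \<and>
            couter T1 = couter T2 \<and> (\<forall>d\<in>couter T1. fnext T1 d = fnext T2 d) \<and>
            (\<forall>k. (flip4 ^^ k) T1 T2 \<longrightarrow> c * real n * ln (real n) \<le> real k)"
    if "n \<ge> max N 4" for n
  proof -
    have n: "n \<ge> N" "4 \<le> n" using that by auto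
    have "(c * real n * ln (real n) + 1) * L = real n * ln (real n) / 2 + L"
      using L by (simp add: c_def field_simps)
    also have "\<dots> < ln (fact (n - 3))"
      using N[OF n(1)] ln_fact_ge[of "n - 3"] n(2) by (simp add: of_nat_diff)
    finally have "(c * real n * ln (real n) + 1) * ln (real D) < ln (fact (n - 3))"
      by (simp add: L_def)
    moreover have "0 \<le> c * real n * ln (real n)"
      using L n(2) by (simp add: c_def)
    ultimately obtain p where p: "p permutes {3..<n}"
      and far: "\<forall>k. (flip4 ^^ k) (fan n id) (fan n p) \<longrightarrow> c * real n * ln (real n) \<le> real k"
      using exists_far_fan[OF n(2) D] by blast
    interpret id: fan_perm n id using n by unfold_locales (auto intro: permutes_id)
    interpret p: fan_perm n p using n p by unfold_locales
    \<comment> \<open>On the outer darts \<open>fnext\<close> involves only the fixed vertices 0, 1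
      and 2, so the cyclic order agrees for all fans.\<close>
    have "\<forall>d\<in>couter (fan n id). fnext (fan n id) d = fnext (fan n p) d"
      by (simp add: id.fan_sel id.outer_def id.fnext_fan id.fnext_2 p.fnext_fan p.fnext_2)
    then show ?thesis
      using id.cppt4_fan p.cppt4_fan far
      by (intro exI[of _ "fan n id"] exI[of _ "fan n p"]) (simp add: fan_def)
  qed
  moreover have "c > 0" using L by (simp add: c_def)
  ultimately show ?thesis by blast
qed

end
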